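(* Let $G$ be a graph on $n$ vertices and $A\in\mathcal{S}(G)$ a matrix with the SSP (respectively, the SMP). Then for every integer $q'$ with $q(A)\le q'\le n$ there is a matrix $A'\in\mathcal{S}(G)$ with the SSP (respectively, the SMP) such that $q(A')=q'$.
   Context: For a graph $G$ on vertex set $\{1,\ldots,n\}$, $\mathcal{S}(G)$ is the set of real symmetric $n\times n$ matrices whose $(i,j)$-entry for $i\neq j$ is nonzero if and only if $\{i,j\}$ is an edge (diagonal entries arbitrary). $q(A)$ is the number of distinct eigenvalues of $A$. $\circ$ is the entrywise product and $[A,X]=AX-XA$. A symmetric matrix $A$ with $q$ distinct eigenvalues has the SSP if $X=O$ is the only real symmetric matrix with $A\circ X=O$, $I\circ X=O$, $[A,X]=O$; it has the SMP if $X=O$ is the only real symmetric matrix with these three conditions and additionally $\operatorname{tr}(A^kX)=0$ for $k=0,\ldots,q-1$. *)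

theory Defs
  imports "HOL-Analysis.Analysis"
begin

text \<open>A simple graph on the vertex type 'n (vertex set = UNIV, n = CARD('n)),
  given by a symmetric irreflexive adjacency relation.\<close>
definition simple_graph :: "('n \<Rightarrow> 'n \<Rightarrow> bool) \<Rightarrow> bool" where
  "simple_graph E \<longleftrightarrow> (\<forall>i j. E i j \<longrightarrow> E j i) \<and> (\<forall>i. \<not> E i i)"

definition sym_mat :: "real^'n^'n \<Rightarrow> bool" where
  "sym_mat A \<longleftrightarrow> transpose A = A"

definition SG :: "('n::finite \<Rightarrow> 'n \<Rightarrow> bool) \<Rightarrow> (real^'n^'n) set" where
  "SG E = {A. sym_mat A \<and> (\<forall>i j. i \<noteq> j \<longrightarrow> (A $ i $ j \<noteq> 0 \<longleftrightarrow> E i j))}"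

definition eigenvalues :: "real^'n^'n \<Rightarrow> real set" where
  "eigenvalues A = {c. \<exists>v. v \<noteq> 0 \<and> A *v v = c *\<^sub>R v}"

definition qnum :: "real^'n^'n \<Rightarrow> nat" where
  "qnum A = card (eigenvalues A)"

primrec matpow :: "real^'n^'n \<Rightarrow> nat \<Rightarrow> real^'n^'n" where
  "matpow A 0 = mat 1"
| "matpow A (Suc k) = A ** matpow A k"

definition SSP :: "real^'n^'n \<Rightarrow> bool" where
  "SSP A \<longleftrightarrow> (\<forall>X::real^'n^'n. sym_mat X \<and> (\<forall>i j. A $ i $ j * X $ i $ j = 0)
      \<and> (\<forall>i. X $ i $ i = 0) \<and> A ** X - X ** A = 0 \<longrightarrow> X = 0)"

definition SMP :: "real^'n^'n \<Rightarrow> bool" where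
  "SMP A \<longleftrightarrow> (\<forall>X::real^'n^'n. sym_mat X \<and> (\<forall>i j. A $ i $ j * X $ i $ j = 0)
      \<and> (\<forall>i. X $ i $ i = 0) \<and> A ** X - X ** A = 0
      \<and> (\<forall>k < qnum A. trace (matpow A k ** X) = 0) \<longrightarrow> X = 0)"

end

theory Submission
  imports Defs
begin

text \<open>
  Write the matrices near \<open>A = P diag(d) P\<^sup>T\<close> as \<open>C\<^sup>T B C\<close> with \<open>C\<close> orthogonal and \<open>B\<close> supported
  on the graph. The SSP says that the derivative of \<open>(B, C) \<mapsto> C\<^sup>T B C\<close> at \<open>(A, I)\<close> is onto the
  symmetric matrices, hence every symmetric \<open>M\<close> near \<open>A\<close> is orthogonally similar to some
  \<open>B\<close> in \<open>SG E\<close> near \<open>A\<close>; choose \<open>M\<close> by splitting multiple eigenvalues of \<open>A\<close>. Under the SMP one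
  only reaches \<open>M\<close> up to adding a small \<open>P diag(g) P\<^sup>T\<close> with \<open>g\<close> a function of \<open>d\<close>; this shifts each
  cluster of eigenvalues as a whole and so does not change the number of distinct eigenvalues.
  Both properties persist near \<open>A\<close> by compactness of the unit sphere of test matrices \<open>X\<close>.
\<close>

subsection \<open>Spectral theorem for real symmetric matrices\<close>

text \<open>A maximiser of the Rayleigh quotient on the unit sphere of \<open>S\<close> is an
  eigenvector. The relative form in \<open>S\<close> allows applying it to orthogonal complements of
  eigenvectors already found.\<close>

lemma symmetric_matrix_eigenvector_in_subspace:
  fixes A :: "real^'n^'n"
  assumes A: "transpose A = A" and S: "subspace S" and inv: "\<And>x. x \<in> S \<Longrightarrow> A *v x \<in> S"
    and ne: "S \<noteq> {0}"
  obtains v c where "v \<in> S" "norm v = 1" "A *v v = c *\<^sub>R v"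
proof -
  have self_adjoint: "(A *v x) \<bullet> y = x \<bullet> (A *v y)" for x y
    by (metis A dot_lmul_matrix transpose_matrix_vector)
  let ?K = "S \<inter> sphere 0 1"
  have "compact ?K"
    using S by (simp add: closed_Int_compact closed_subspace)
  moreover have "?K \<noteq> {}"
  proof -
    obtain x where "x \<in> S" "x \<noteq> 0" using ne S subspace_0 by blast
    then have "(1 / norm x) *\<^sub>R x \<in> ?K" using S by (simp add: subspace_scale)
    then show ?thesis by blast
  qed
  moreover have "continuous_on ?K (\<lambda>x. x \<bullet> (A *v x))"
    by (intro continuous_intros matrix_vector_mult_linear_continuous_on)
  ultimately obtain v where v: "v \<in> ?K" and max: "\<And>y. y \<in> ?K \<Longrightarrow> y \<bullet> (A *v y) \<le> v \<bullet> (A *v v)"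
    by (metis (no_types, lifting) continuous_attains_sup)
  define c where "c = v \<bullet> (A *v v)"
  define q where "q = (\<lambda>y. c * (y \<bullet> y) - y \<bullet> (A *v y))"
  have q_nonneg: "q y \<ge> 0" if "y \<in> S" for y
  proof (cases "y = 0")
    case False
    have "(1 / norm y) *\<^sub>R y \<in> ?K" using S that False by (simp add: subspace_scale)
    from max[OF this] have "(y \<bullet> (A *v y)) / (norm y)\<^sup>2 \<le> c"
      by (simp add: c_def matrix_vector_mult_scaleR power2_eq_square)
    then show ?thesis using False by (simp add: q_def field_simps power2_norm_eq_inner)
  qed (simp add: q_def)
  have vv: "v \<bullet> v = 1" using v by (simp add: norm_eq_1)
  \<comment> \<open>The form \<open>q\<close> is nonnegative on \<open>S\<close> and vanishes at
    \<open>v\<close>, so its derivative there along \<open>S\<close> must vanish; \<open>w\<close>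
    is half the gradient of \<open>q\<close> at \<open>v\<close>.\<close>
  define w where "w = c *\<^sub>R v - A *v v"
  have wS: "w \<in> S" using v inv S by (simp add: w_def subspace_diff subspace_scale)
  have expand: "q (v + t *\<^sub>R w) = 2 * t * (w \<bullet> w) + t\<^sup>2 * q w" for t
  proof -
    have "q (v + t *\<^sub>R w) = q v + 2 * t * (c * (v \<bullet> w) - (A *v v) \<bullet> w) + t\<^sup>2 * q w"
      unfolding q_def using self_adjoint[of v w]
      by (simp add: matrix_vector_right_distrib matrix_vector_mult_scaleR inner_simps
          inner_commute algebra_simps power2_eq_square)
    moreover have "q v = 0" by (simp add: q_def c_def vv)
    moreover have "c * (v \<bullet> w) - (A *v v) \<bullet> w = w \<bullet> w"
      unfolding w_def by (simp only: inner_diff_left inner_scaleR_left)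
    ultimately show ?thesis by simp
  qed
  have "w \<bullet> w = 0"
  proof (rule ccontr)
    assume "w \<bullet> w \<noteq> 0"
    then have pos: "w \<bullet> w > 0" by simp
    have qw: "q w \<ge> 0" using q_nonneg wS by simp
    \<comment> \<open>A step against the gradient, short enough that the linear term outweighs the
      quadratic one; the \<open>+ 1\<close> covers \<open>q w = 0\<close>.\<close>
    define t where "t = - (w \<bullet> w) / (q w + 1)"
    have t: "t < 0" using pos qw by (simp add: t_def field_simps)
    have "v + t *\<^sub>R w \<in> S" using v wS S by (simp add: subspace_add subspace_scale)
    then have "0 \<le> t * (2 * (w \<bullet> w) + t * q w)"
      using q_nonneg[of "v + t *\<^sub>R w"] expand[of t] by (simp add: algebra_simps power2_eq_square)
    moreover have "- t * q w < 2 * (w \<bullet> w)"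
      using pos qw by (simp add: t_def field_simps add_nonneg_pos del: inner_gt_zero_iff)
    ultimately show False using t by (simp add: zero_le_mult_iff)
  qed
  then have "A *v v = c *\<^sub>R v" by (simp add: w_def)
  then show thesis using that v by auto
qed

text \<open>An orthonormal set of eigenvectors of maximal size spans the space: otherwise its
  orthogonal complement is a nonzero invariant subspace and contributes one more
  eigenvector.\<close>

lemma symmetric_matrix_orthonormal_eigenbasis:
  fixes A :: "real^'n^'n"
  assumes A: "transpose A = A"
  obtains V where "pairwise orthogonal V" "finite V" "card V = CARD('n)"
    "\<And>v. v \<in> V \<Longrightarrow> norm v = 1 \<and> (\<exists>c. A *v v = c *\<^sub>R v)"
proof -
  define Q where "Q = (\<lambda>V. pairwise orthogonal V \<and> (\<forall>v\<in>V. norm v = 1 \<and> (\<exists>c. A *v v = c *\<^sub>R v)))"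
  have ind: "independent V" if "Q V" for V
    using that pairwise_orthogonal_independent[of V] unfolding Q_def by force
  have bd: "finite V \<and> card V \<le> CARD('n)" if "Q V" for V
    using independent_bound[OF ind[OF that]] by simp
  have "Q {}" by (simp add: Q_def)
  moreover have "\<forall>V. Q V \<longrightarrow> card V < CARD('n) + 1" using bd by (simp add: le_imp_less_Suc)
  ultimately obtain V where V: "Q V" and maxV: "\<And>W. Q W \<Longrightarrow> card W \<le> card V"
    using ex_has_greatest_nat[of Q "{}" card "CARD('n) + 1"] by blast
  have "span V = UNIV"
  proof (rule ccontr)
    assume "span V \<noteq> UNIV"
    then obtain x where x: "x \<noteq> 0" "\<forall>y\<in>span V. x \<bullet> y = 0"
      using span_not_UNIV_orthogonal by blast
    let ?S = "{y. \<forall>v\<in>V. orthogonal v y}"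
    have S: "subspace ?S"
      by (auto simp: subspace_def orthogonal_def inner_simps)
    have inv: "A *v y \<in> ?S" if "y \<in> ?S" for y
    proof -
      have "v \<bullet> (A *v y) = 0" if "v \<in> V" for v
      proof -
        obtain c where "A *v v = c *\<^sub>R v" using V \<open>v \<in> V\<close> by (auto simp: Q_def)
        moreover have "v \<bullet> (A *v y) = (A *v v) \<bullet> y"
          by (metis A dot_lmul_matrix transpose_matrix_vector)
        ultimately show ?thesis using \<open>y \<in> ?S\<close> \<open>v \<in> V\<close> by (simp add: orthogonal_def)
      qed
      then show ?thesis by (simp add: orthogonal_def)
    qed
    have "x \<in> ?S" using x by (auto simp: orthogonal_def span_base inner_commute)
    then have "?S \<noteq> {0}" using x by blast
    from symmetric_matrix_eigenvector_in_subspace[OF A S inv this]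
    obtain u c where u: "u \<in> ?S" "norm u = 1" "A *v u = c *\<^sub>R u" by metis
    have "u \<notin> V" using u by (auto simp: orthogonal_def norm_eq_1)
    moreover have "Q (insert u V)"
      using V u unfolding Q_def pairwise_insert by (auto simp: orthogonal_commute)
    ultimately show False using maxV[of "insert u V"] bd[OF V] by simp
  qed
  then have "card V = CARD('n)"
    using dim_eq_card_independent[OF ind[OF V]] dim_span[of V] by simp
  then show thesis using that V bd[OF V] unfolding Q_def by blast
qed

text \<open>With \<open>P\<close> fixed this is linear in \<open>g\<close>. The matrix
  \<open>A\<close>, its powers, the target \<open>M\<close> and the correction term are all values
  of this one map.\<close>

definition spectral_mat :: "real^'n^'n \<Rightarrow> ('n \<Rightarrow> real) \<Rightarrow> real^'n^'n" where
  "spectral_mat P g = P ** (\<chi> i j. if i = j then g i else 0) ** transpose P"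

theorem symmetric_matrix_spectral:
  fixes A :: "real^'n^'n"
  assumes A: "transpose A = A"
  obtains P d where "orthogonal_matrix P" "A = spectral_mat P d"
proof -
  obtain V where V: "pairwise orthogonal V" "finite V" "card V = CARD('n)"
    "\<And>v. v \<in> V \<Longrightarrow> norm v = 1 \<and> (\<exists>c. A *v v = c *\<^sub>R v)"
    using symmetric_matrix_orthonormal_eigenbasis[OF A] by blast
  obtain b where b: "bij_betw b (UNIV::'n set) V"
    using V finite_same_card_bij[of "UNIV::'n set" V] by auto
  then have bV: "b i \<in> V" for i by (auto simp: bij_betw_def)
  have "\<forall>i. \<exists>c. A *v b i = c *\<^sub>R b i" using V(4) bV by blast
  then obtain d where d: "\<And>i. A *v b i = d i *\<^sub>R b i" using choice[of "\<lambda>i c. A *v b i = c *\<^sub>R b i"] by blast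
  define P where "P = (\<chi> i j. b j $ i)"
  have col: "column j P = b j" for j by (simp add: P_def column_def vec_eq_iff)
  have orth: "orthogonal (b i) (b j)" if "i \<noteq> j" for i j
    using V(1) bV b that by (metis bij_betw_imp_inj_on inj_eq pairwiseD)
  have P: "orthogonal_matrix P"
    unfolding orthogonal_matrix_orthonormal_columns col using V(4) bV orth by blast
  let ?D = "(\<chi> i j. if i = j then d i else 0) :: real^'n^'n"
  have "A ** P = P ** ?D"
  proof -
    have "(A ** P) $ i $ j = (P ** ?D) $ i $ j" for i j
      using arg_cong[OF d[of j], of "\<lambda>x. x $ i"]
      by (simp add: matrix_matrix_mult_def matrix_vector_mult_def P_def if_distrib cong: if_cong)
    then show ?thesis by (simp add: vec_eq_iff)
  qed
  then have "A ** (P ** transpose P) = spectral_mat P d"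
    by (simp add: spectral_mat_def matrix_mul_assoc)
  then have "A = spectral_mat P d" using P by (simp add: orthogonal_matrix_def)
  then show thesis using that P by blast
qed

section \<open>Eigenvalues and powers of spectral matrices\<close>

lemma eigenvalues_orthogonal_conj:
  fixes B :: "real^'n^'n"
  assumes "orthogonal_matrix C"
  shows "eigenvalues (transpose C ** B ** C) = eigenvalues B"
proof -
  \<comment> \<open>One inclusion suffices, since conjugation by \<open>transpose C\<close> undoes
    conjugation by \<open>C\<close>.\<close>
  have *: "eigenvalues B \<subseteq> eigenvalues (transpose C ** B ** C)"
    if C: "orthogonal_matrix C" for B C :: "real^'n^'n"
  proof
    fix c assume "c \<in> eigenvalues B"
    then obtain v where v: "v \<noteq> 0" "B *v v = c *\<^sub>R v" by (auto simp: eigenvalues_def)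
    have CC: "C *v (transpose C *v v) = v" for v
      using C by (simp only: matrix_vector_mul_assoc orthogonal_matrix_def matrix_vector_mul_lid)
    have "(transpose C ** B ** C) *v (transpose C *v v) = c *\<^sub>R (transpose C *v v)"
      by (simp only: matrix_vector_mul_assoc[symmetric] CC v matrix_vector_mult_scaleR)
    moreover have "transpose C *v v \<noteq> 0" using CC[of v] v by (metis matrix_vector_mult_0_right)
    ultimately show "c \<in> eigenvalues (transpose C ** B ** C)" unfolding eigenvalues_def by blast
  qed
  have "C ** (transpose C ** B ** C) ** transpose C = (C ** transpose C) ** B ** (C ** transpose C)"
    by (simp only: matrix_mul_assoc)
  then have "C ** (transpose C ** B ** C) ** transpose C = B"
    using assms by (simp add: orthogonal_matrix_def)
  then show ?thesis
    using *[OF assms, of B] *[of "transpose C" "transpose C ** B ** C"] assms by simp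
qed

lemma diag_mult_vec: "(\<chi> i j. if i = j then g i else 0) *v (v::real^'n) = (\<chi> i. g i * v $ i)"
  by (simp add: matrix_vector_mult_def vec_eq_iff if_distrib if_distribR cong: if_cong)

lemma eigenvalues_diag: "eigenvalues (\<chi> i j. if i = j then g i else 0) = range g"
proof
  show "eigenvalues (\<chi> i j. if i = j then g i else 0) \<subseteq> range g"
    by (auto simp: eigenvalues_def diag_mult_vec vec_eq_iff)
  show "range g \<subseteq> eigenvalues (\<chi> i j. if i = j then g i else 0)"
  proof
    fix c assume "c \<in> range g"
    then obtain i where "c = g i" by auto
    then show "c \<in> eigenvalues (\<chi> i j. if i = j then g i else 0)"
      unfolding eigenvalues_def diag_mult_vec
      by (auto intro!: exI[of _ "axis i 1"] simp: vec_eq_iff axis_def axis_eq_0_iff)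
  qed
qed

lemma eigenvalues_spectral_mat:
  assumes "orthogonal_matrix P"
  shows "eigenvalues (spectral_mat P g) = range g"
  using eigenvalues_orthogonal_conj[of "transpose P" "\<chi> i j. if i = j then g i else 0"] assms
  by (simp add: spectral_mat_def eigenvalues_diag)

lemma transpose_spectral_mat: "transpose (spectral_mat P g) = spectral_mat P g"
proof -
  have "transpose (\<chi> i j. if i = j then g i else 0) = (\<chi> i j. if i = j then g i else 0)"
    by (auto simp: transpose_def vec_eq_iff)
  then show ?thesis by (simp add: spectral_mat_def matrix_transpose_mul matrix_mul_assoc)
qed

lemma spectral_mat_entry: "spectral_mat P g $ i $ j = (\<Sum>k\<in>UNIV. g k * (P $ i $ k * P $ j $ k))"
  by (simp add: spectral_mat_def matrix_matrix_mult_def transpose_def if_distrib cong: if_cong)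
    (simp add: ac_simps)

lemma spectral_mat_add: "spectral_mat P (\<lambda>i. f i + g i) = spectral_mat P f + spectral_mat P g"
  by (simp add: vec_eq_iff spectral_mat_entry sum.distrib distrib_right)

lemma spectral_mat_scale: "spectral_mat P (\<lambda>i. c * g i) = c *\<^sub>R spectral_mat P g"
  by (simp add: vec_eq_iff spectral_mat_entry sum_distrib_left mult.assoc)

lemma matpow_spectral_mat:
  fixes P :: "real^'n^'n"
  assumes P: "orthogonal_matrix P"
  shows "matpow (spectral_mat P d) k = spectral_mat P (\<lambda>i. d i ^ k)"
proof (induction k)
  case 0
  have "(\<chi> i j. if i = j then 1 else 0) = (mat 1 :: real^'n^'n)" by (simp add: mat_def)
  then show ?case using P by (simp add: spectral_mat_def orthogonal_matrix_def)
next
  case (Suc k)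
  let ?D = "\<lambda>g. (\<chi> i j. if i = j then g i else 0) :: real^'n^'n"
  have "spectral_mat P d ** spectral_mat P (\<lambda>i. d i ^ k)
      = P ** ?D d ** (transpose P ** P) ** ?D (\<lambda>i. d i ^ k) ** transpose P"
    by (simp only: spectral_mat_def matrix_mul_assoc)
  also have "\<dots> = P ** (?D d ** ?D (\<lambda>i. d i ^ k)) ** transpose P"
    using P by (simp add: orthogonal_matrix_def matrix_mul_assoc)
  also have "?D d ** ?D (\<lambda>i. d i ^ k) = ?D (\<lambda>i. d i ^ Suc k)"
    by (simp add: matrix_eq matrix_vector_mul_assoc[symmetric] diag_mult_vec vec_eq_iff mult.assoc)
  finally show ?case unfolding matpow.simps Suc by (simp only: spectral_mat_def)
qed

subsection \<open>Openness of the SSP and the SMP\<close>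

lemma bounded_bilinear_matrix_mult:
  "bounded_bilinear ((**) :: real^'n^'m \<Rightarrow> real^'p^'n \<Rightarrow> real^'p^'m)"
proof -
  have "bilinear ((**) :: real^'n^'m \<Rightarrow> real^'p^'n \<Rightarrow> real^'p^'m)"
    unfolding bilinear_def
    by (auto intro!: linearI simp: matrix_matrix_mult_def vec_eq_iff sum.distrib
        sum_distrib_left algebra_simps)
  then show ?thesis by (simp add: bilinear_conv_bounded_bilinear)
qed

lemma transpose_add: "transpose (A + B) = transpose A + transpose (B :: real^'n^'m)"
  by (simp add: transpose_def vec_eq_iff)

lemma transpose_diff: "transpose (A - B) = transpose A - transpose (B :: real^'n^'m)"
  by (simp add: transpose_def vec_eq_iff)

lemma bounded_linear_transpose: "bounded_linear (transpose :: real^'n^'m \<Rightarrow> real^'m^'n)"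
  by (simp add: linear_conv_bounded_linear[symmetric])
    (auto intro!: linearI simp: transpose_def vec_eq_iff)

lemmas continuous_on_matrix_mult = bounded_bilinear.continuous_on[OF bounded_bilinear_matrix_mult]
lemmas continuous_on_transpose = bounded_linear.continuous_on[OF bounded_linear_transpose]
lemmas has_derivative_matrix_mult = bounded_bilinear.FDERIV[OF bounded_bilinear_matrix_mult]
lemmas has_derivative_transpose = bounded_linear.has_derivative[OF bounded_linear_transpose]

lemma continuous_on_matpow:
  "continuous_on S f \<Longrightarrow> continuous_on S (\<lambda>x. matpow (f x) k)"
  by (induction k) (auto intro!: continuous_on_matrix_mult continuous_intros)

lemma inner_matrix: "(X :: real^'n^'m) \<bullet> Y = (\<Sum>i\<in>UNIV. \<Sum>j\<in>UNIV. X $ i $ j * Y $ i $ j)"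
  by (simp add: inner_vec_def)

lemma trace_matrix_mult: "trace ((X :: real^'n^'n) ** Y) = transpose X \<bullet> Y"
  by (simp add: trace_def inner_matrix matrix_matrix_mult_def transpose_def)
    (rule sum.swap)

lemma inner_transpose: "(X :: real^'n^'m) \<bullet> transpose Y = transpose X \<bullet> Y"
  by (simp add: inner_matrix transpose_def) (rule sum.swap)

lemma inner_matrix_mult_left: "(X :: real^'p^'m) \<bullet> ((A :: real^'n^'m) ** L) = (transpose A ** X) \<bullet> L"
proof -
  have "X \<bullet> (A ** L) = (\<Sum>i\<in>UNIV. \<Sum>j\<in>UNIV. \<Sum>k\<in>UNIV. A $ i $ k * X $ i $ j * L $ k $ j)"
    by (simp add: inner_matrix matrix_matrix_mult_def sum_distrib_left ac_simps)
  also have "\<dots> = (\<Sum>k\<in>UNIV. \<Sum>j\<in>UNIV. \<Sum>i\<in>UNIV. A $ i $ k * X $ i $ j * L $ k $ j)"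
    by (subst sum.swap, subst (2) sum.swap, subst sum.swap) simp
  also have "\<dots> = (transpose A ** X) \<bullet> L"
    by (simp add: inner_matrix matrix_matrix_mult_def transpose_def sum_distrib_right)
  finally show ?thesis .
qed

text \<open>Brings surjectivity of a derivative into the shape of the SSP and the SMP, where a test
  matrix subject to linear conditions must be zero.\<close>

lemma linear_surj_if_no_orthogonal:
  fixes f :: "'a::euclidean_space \<Rightarrow> 'b::euclidean_space"
  assumes f: "linear f" and "\<And>w. (\<And>z. w \<bullet> f z = 0) \<Longrightarrow> w = 0"
  shows "surj f"
proof (rule ccontr)
  assume "\<not> surj f"
  moreover have "span (range f) = range f"
    using linear_subspace_image[OF f subspace_UNIV] by (simp add: span_eq_iff)
  ultimately obtain w where "w \<noteq> 0" "\<forall>y\<in>range f. w \<bullet> y = 0"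
    using span_not_UNIV_orthogonal[of "range f"] by metis
  then show False using assms(2)[of w] by auto
qed

text \<open>For \<open>A\<close> in \<open>SG E\<close>, \<open>m = 0\<close> is the SSP and \<open>m = qnum A\<close> is the SMP.\<close>
definition SMP_upto :: "('n::finite \<Rightarrow> 'n \<Rightarrow> bool) \<Rightarrow> nat \<Rightarrow> real^'n^'n \<Rightarrow> bool" where
  "SMP_upto E m A \<longleftrightarrow> (\<forall>X. transpose X = X \<and> (\<forall>i j. i = j \<or> E i j \<longrightarrow> X $ i $ j = 0)
      \<and> A ** X = X ** A \<and> (\<forall>k<m. trace (matpow A k ** X) = 0) \<longrightarrow> X = 0)"

text \<open>More trace conditions leave fewer test matrices.\<close>

lemma SMP_upto_mono: "SMP_upto E m A \<Longrightarrow> m \<le> m' \<Longrightarrow> SMP_upto E m' A"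
  unfolding SMP_upto_def by (meson less_le_trans)

text \<open>On \<open>SG E\<close> the entrywise conditions depend on the graph alone. Only the
  commutator and the traces then vary with \<open>A\<close>, and they do so continuously.\<close>

lemma SG_pattern_iff:
  assumes "simple_graph E" "A \<in> SG E"
  shows "(\<forall>i j. A $ i $ j * X $ i $ j = 0) \<and> (\<forall>i. X $ i $ i = 0)
    \<longleftrightarrow> (\<forall>i j. i = j \<or> E i j \<longrightarrow> X $ i $ j = 0)"
proof -
  have "(A $ i $ j * X $ i $ j = 0 \<and> X $ i $ i = 0)
      \<longleftrightarrow> (E i j \<longrightarrow> X $ i $ j = 0) \<and> X $ i $ i = 0" for i j
    using assms by (cases "i = j") (auto simp: SG_def simple_graph_def)
  then have "(\<forall>i j. A $ i $ j * X $ i $ j = 0 \<and> X $ i $ i = 0)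
      \<longleftrightarrow> (\<forall>i j. (E i j \<longrightarrow> X $ i $ j = 0) \<and> X $ i $ i = 0)" by simp
  then show ?thesis by blast
qed

lemma SSP_iff_SMP_upto:
  assumes "simple_graph E" "A \<in> SG E"
  shows "SSP A \<longleftrightarrow> SMP_upto E 0 A"
  unfolding SMP_upto_def SG_pattern_iff[OF assms, symmetric]
  by (simp add: SSP_def sym_mat_def conj_assoc)

lemma SMP_iff_SMP_upto:
  assumes "simple_graph E" "A \<in> SG E"
  shows "SMP A \<longleftrightarrow> SMP_upto E (qnum A) A"
  unfolding SMP_upto_def SG_pattern_iff[OF assms, symmetric]
  by (simp add: SMP_def sym_mat_def conj_assoc)

text \<open>The conditions are homogeneous in \<open>X\<close>, so a nonzero violator can be
  normalised. The complement is thus the projection of a closed set along the compact unit sphere,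
  hence closed. Keeping \<open>m\<close> fixed matters here, because \<open>qnum\<close> is not
  continuous.\<close>

lemma open_SMP_upto:
  fixes E :: "'n::finite \<Rightarrow> 'n \<Rightarrow> bool"
  shows "open {A. SMP_upto E m A}"
proof -
  define Z where "Z = {(X, A). transpose X = X \<and> (\<forall>i j. i = j \<or> E i j \<longrightarrow> X $ i $ j = 0)
      \<and> A ** X = X ** A \<and> (\<forall>k<m. trace (matpow A k ** X) = 0)}"
  have "Z = {z. transpose (fst z) = fst z} \<inter> (\<Inter>(i,j)\<in>{(i,j). i = j \<or> E i j}. {z. fst z $ i $ j = 0})
      \<inter> {z. snd z ** fst z = fst z ** snd z}
      \<inter> (\<Inter>k\<in>{..<m}. {z. trace (matpow (snd z) k ** fst z) = 0})"
    unfolding Z_def by auto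
  moreover have "closed \<dots>"
    unfolding trace_def
    by (intro closed_Int closed_INT ballI closed_Collect_eq continuous_on_transpose
        continuous_on_matrix_mult continuous_on_matpow continuous_intros)
      (auto intro!: closed_Collect_eq continuous_intros)
  ultimately have "closed Z" by simp
  then have "closed {A. \<exists>X. X \<in> sphere 0 1 \<and> (X, A) \<in> Z}"
    by (intro closed_compact_projection) auto
  moreover have "{A. \<exists>X. X \<in> sphere 0 1 \<and> (X, A) \<in> Z} = - {A. SMP_upto E m A}"
  proof -
    have "\<exists>Y. Y \<in> sphere 0 1 \<and> (Y, A) \<in> Z" if "(X, A) \<in> Z" "X \<noteq> 0" for X A
    proof (intro exI conjI)
      show "(1 / norm X) *\<^sub>R X \<in> sphere 0 1" using that by simp
      show "((1 / norm X) *\<^sub>R X, A) \<in> Z"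
        using that unfolding Z_def
        by (auto simp: transpose_scalar trace_matrix_mult
            bounded_bilinear.scaleR_left[OF bounded_bilinear_matrix_mult]
            bounded_bilinear.scaleR_right[OF bounded_bilinear_matrix_mult])
    qed
    moreover have "SMP_upto E m A \<longleftrightarrow> (\<forall>X. (X, A) \<in> Z \<longrightarrow> X = 0)" for A
      by (simp add: SMP_upto_def Z_def)
    moreover have "X \<noteq> 0" if "X \<in> sphere 0 1" for X :: "real^'n^'n" using that by auto
    ultimately show ?thesis by blast
  qed
  ultimately show ?thesis by (metis closed_def double_complement)
qed

subsection \<open>Perturbation inside the pattern of the graph\<close>

text \<open>For symmetric \<open>E\<close>, a linear projection onto the symmetric matrices
  supported on the diagonal and the edges; it parametrises them by a full Euclidean space.\<close>

definition pattern_part :: "('n::finite \<Rightarrow> 'n \<Rightarrow> bool) \<Rightarrow> real^'n^'n \<Rightarrow> real^'n^'n" where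
  "pattern_part E Y = (\<chi> i j. if i = j \<or> E i j then (Y $ i $ j + Y $ j $ i) / 2 else 0)"

lemma bounded_linear_pattern_part: "bounded_linear (pattern_part E)"
  by (simp add: linear_conv_bounded_linear[symmetric])
    (auto intro!: linearI simp: pattern_part_def vec_eq_iff field_simps)

lemma transpose_pattern_part:
  "simple_graph E \<Longrightarrow> transpose (pattern_part E Y) = pattern_part E Y"
  by (auto simp: pattern_part_def simple_graph_def transpose_def vec_eq_iff)

lemma pattern_part_SG:
  assumes "A \<in> SG E"
  shows "pattern_part E A = A"
proof -
  have "A $ j $ i = A $ i $ j" for i j
    using assms by (metis (mono_tags, lifting) SG_def mem_Collect_eq sym_mat_def transpose_def vec_lambda_beta)
  then show ?thesis using assms by (auto simp: pattern_part_def SG_def vec_eq_iff)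
qed

lemma inner_pattern_part_self:
  assumes "transpose X = X"
  shows "X \<bullet> pattern_part E X = pattern_part E X \<bullet> pattern_part E X"
proof -
  have "X $ j $ i = X $ i $ j" for i j
    using assms by (metis transpose_def vec_lambda_beta)
  then show ?thesis by (simp add: inner_matrix pattern_part_def) (auto intro!: sum.cong)
qed

lemma bounded_linear_skew: "bounded_linear (\<lambda>U::real^'n^'n. U - transpose U)"
  by (intro bounded_linear_sub bounded_linear_ident bounded_linear_transpose)

text \<open>Taking \<open>U\<close> to be \<open>X - transpose X\<close> turns the hypothesis into
  \<open>U \<bullet> U = 0\<close>.\<close>

lemma symmetric_if_orthogonal_to_skew:
  fixes X :: "real^'n^'n"
  assumes "\<And>U. X \<bullet> (U - transpose U) = 0"
  shows "transpose X = X"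
proof -
  let ?U = "X - transpose X"
  have "?U \<bullet> ?U = X \<bullet> ?U - X \<bullet> transpose ?U"
    by (simp only: inner_diff_left inner_transpose)
  then have "?U \<bullet> ?U = 0" using assms[of ?U] by (simp only: inner_diff_right)
  then show ?thesis by simp
qed

text \<open>Symmetric and skew matrices meet only in zero. This discards the auxiliary skew terms
  once a preimage is found.\<close>

lemma symmetric_eq_if_differ_by_skew:
  fixes U :: "real^'n^'n"
  assumes "transpose M = M" "transpose N = N" "M + (U - transpose U) = N"
  shows "M = N"
proof -
  have "transpose M + (transpose U - U) = transpose N"
    using arg_cong[OF assms(3), of transpose] by (simp add: transpose_add transpose_diff)
  then have eq: "M + (transpose U - U) = N" using assms by simp
  have "2 *\<^sub>R M = (M + (U - transpose U)) + (M + (transpose U - U))" by (simp add: scaleR_2)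
  also have "\<dots> = 2 *\<^sub>R N" unfolding assms(3) eq by (simp add: scaleR_2)
  finally show ?thesis by simp
qed

lemma has_derivative_congruence:
  fixes L B :: "'a::real_normed_vector \<Rightarrow> real^'n^'n"
  assumes L: "bounded_linear L" "L z = 0" and B: "(B has_derivative B') (at z)"
  shows "((\<lambda>z. transpose (mat 1 + L z) ** B z ** (mat 1 + L z)) has_derivative
    (\<lambda>h. transpose (L h) ** B z + B' h + B z ** L h)) (at z)"
proof -
  have C: "((\<lambda>z. mat 1 + L z) has_derivative L) (at z)"
    using bounded_linear_imp_has_derivative[OF L(1)]
    by (intro has_derivative_eq_rhs[OF has_derivative_add[OF has_derivative_const]]) auto
  show ?thesis
    by (rule has_derivative_eq_rhs[OF has_derivative_matrix_mult[OF has_derivative_matrix_mult[OF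
        has_derivative_transpose[OF C] B] C]]) (simp add: L fun_eq_iff add.commute)
qed

lemma linear_spectral_mat: "linear (\<lambda>x::real^'n. spectral_mat P (\<lambda>i. x $ h i))"
  using spectral_mat_add[of P "\<lambda>i. _ $ h i" "\<lambda>i. _ $ h i"] spectral_mat_scale[of P _ "\<lambda>i. _ $ h i"]
  by (auto intro!: linearI)

text \<open>The orthogonality constraint on \<open>C\<close> is carried along as a second component, and skew parts are
  added, so that the map goes between full Euclidean spaces, is polynomial, and has a surjective
  derivative exactly because of \<open>SMP_upto\<close>.\<close>
lemma congruence_locally_onto:
  fixes E :: "'n::finite \<Rightarrow> 'n \<Rightarrow> bool" and A :: "real^'n^'n"
  assumes E: "simple_graph E" and A: "A \<in> SG E" and smp: "SMP_upto E m A"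
    and P: "orthogonal_matrix P" and AP: "A = spectral_mat P d" and h: "\<And>i. d (h i) = d i"
    and W: "open W" "A \<in> W" and e: "e > 0"
  obtains \<delta> where "\<delta> > 0"
    "\<And>M. \<lbrakk>transpose M = M; dist M A < \<delta>\<rbrakk> \<Longrightarrow> \<exists>Y C x. pattern_part E Y \<in> W \<and> norm (x::real^'n) < e
      \<and> orthogonal_matrix C
      \<and> transpose C ** pattern_part E Y ** C = M + spectral_mat P (\<lambda>i. x $ h i)"
proof -
  define S where "S = (\<lambda>x::real^'n. spectral_mat P (\<lambda>i. x $ h i))"
  have S: "bounded_linear S"
    using linear_spectral_mat[of P h] by (simp add: S_def linear_conv_bounded_linear)
  define sk where "sk = (\<lambda>U::real^'n^'n. U - transpose U)"
  have sk: "bounded_linear sk" unfolding sk_def by (rule bounded_linear_skew)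
  let ?p = "pattern_part E"
  let ?Y = "\<lambda>z. ?p (fst z)" and ?L = "\<lambda>z. fst (snd z)" and ?x = "\<lambda>z. S (fst (snd (snd z)))"
    and ?U = "\<lambda>z. sk (fst (snd (snd (snd z))))" and ?V = "\<lambda>z. sk (snd (snd (snd (snd z))))"
  note fs = bounded_linear_compose[OF bounded_linear_fst] bounded_linear_compose[OF bounded_linear_snd]
  have lin: "bounded_linear ?Y" "bounded_linear ?L" "bounded_linear ?x"
    "bounded_linear ?U" "bounded_linear ?V"
    by (intro bounded_linear_compose[OF bounded_linear_pattern_part] bounded_linear_compose[OF S]
        bounded_linear_compose[OF sk] fs bounded_linear_fst bounded_linear_snd)+
  \<comment> \<open>The arguments are \<open>Y\<close>, then \<open>L\<close> with
    \<open>C = mat 1 + L\<close>, then \<open>x\<close> and the two skew parameters. The inner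
    \<open>mat 1\<close> in the second component makes it a congruence too, so one derivative lemma
    serves both.\<close>
  define F where "F = (\<lambda>z::(real^'n^'n) \<times> (real^'n^'n) \<times> (real^'n) \<times> (real^'n^'n) \<times> (real^'n^'n).
    (transpose (mat 1 + ?L z) ** ?Y z ** (mat 1 + ?L z) - ?x z + ?U z,
     transpose (mat 1 + ?L z) ** mat 1 ** (mat 1 + ?L z) + ?V z))"
  define F' where "F' = (\<lambda>z::(real^'n^'n) \<times> (real^'n^'n) \<times> (real^'n) \<times> (real^'n^'n) \<times> (real^'n^'n).
    (transpose (?L z) ** A + ?Y z + A ** ?L z - ?x z + ?U z,
     transpose (?L z) ** mat 1 + 0 + mat 1 ** ?L z + ?V z))"
  let ?z = "(A, 0, 0, 0, 0) :: (real^'n^'n) \<times> (real^'n^'n) \<times> (real^'n) \<times> (real^'n^'n) \<times> (real^'n^'n)"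
  have symA: "transpose A = A" using A by (simp add: SG_def sym_mat_def)
  have Yz: "?Y ?z = A" using pattern_part_SG[OF A] by simp
  have der: "(F has_derivative F') (at ?z)"
  proof -
    have 1: "((\<lambda>z. transpose (mat 1 + ?L z) ** ?Y z ** (mat 1 + ?L z)) has_derivative
        (\<lambda>z. transpose (?L z) ** A + ?Y z + A ** ?L z)) (at ?z)"
      using has_derivative_congruence[OF lin(2) _ bounded_linear_imp_has_derivative[OF lin(1)], of ?z]
      unfolding Yz by simp
    have 2: "((\<lambda>z. transpose (mat 1 + ?L z) ** mat 1 ** (mat 1 + ?L z)) has_derivative
        (\<lambda>z. transpose (?L z) ** mat 1 + 0 + mat 1 ** ?L z)) (at ?z)"
      by (rule has_derivative_congruence[OF lin(2) _ has_derivative_const]) simp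
    show ?thesis unfolding F_def F'_def
      by (intro has_derivative_Pair has_derivative_add has_derivative_diff 1 2
          bounded_linear_imp_has_derivative lin)
  qed
  then have linF': "linear F'"
    using has_derivative_bounded_linear bounded_linear.linear by blast
  have "surj F'"
  proof (rule linear_surj_if_no_orthogonal[OF linF'])
    fix w :: "(real^'n^'n) \<times> (real^'n^'n)"
    assume orth: "\<And>z. w \<bullet> F' z = 0"
    obtain X Z where w: "w = (X, Z)" by (cases w)
    have S0: "S 0 = 0" and sk0: "sk 0 = 0" and p0: "?p 0 = 0"
      and t0: "transpose (0 :: real^'n^'n) = 0"
      using S sk bounded_linear_pattern_part bounded_linear_transpose
      by (auto dest: bounded_linear.linear linear_0)
    have mult0: "(0::real^'n^'n) ** A = 0" "A ** (0::real^'n^'n) = 0"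
      by (simp_all add: matrix_matrix_mult_def vec_eq_iff)
    note zero = S0 sk0 p0 t0 mult0
    \<comment> \<open>Each argument of \<open>F'\<close> is tested separately: the skew parameters
      give symmetry, \<open>Y\<close> the zero pattern, \<open>L\<close> the commutation and
      \<open>x\<close> the traces.\<close>
    have "X \<bullet> sk U = 0" for U
      using orth[of "(0, 0, 0, U, 0)"] by (simp add: w F'_def zero)
    then have X: "transpose X = X"
      unfolding sk_def by (rule symmetric_if_orthogonal_to_skew)
    have "Z \<bullet> sk V = 0" for V
      using orth[of "(0, 0, 0, 0, V)"] by (simp add: w F'_def zero)
    then have Z: "transpose Z = Z"
      unfolding sk_def by (rule symmetric_if_orthogonal_to_skew)
    have "X \<bullet> ?p X = 0"
      using orth[of "(X, 0, 0, 0, 0)"] by (simp add: w F'_def zero)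
    then have "?p X = 0" by (simp add: inner_pattern_part_self[OF X])
    moreover have "X $ j $ i = X $ i $ j" for i j
      using X by (metis transpose_def vec_lambda_beta)
    moreover have "?p X $ i $ j = (X $ i $ j + X $ j $ i) / 2" if "i = j \<or> E i j" for i j
      using that by (simp add: pattern_part_def)
    ultimately have pat: "\<forall>i j. i = j \<or> E i j \<longrightarrow> X $ i $ j = 0" by simp
    \<comment> \<open>Here \<open>Z\<close> acts as a Lagrange multiplier for orthogonality:
      \<open>A ** X = - Z\<close> is symmetric, and so equals its transpose
      \<open>X ** A\<close>.\<close>
    have "(A ** X + Z) \<bullet> L = 0" for L
    proof -
      have "X \<bullet> (transpose L ** A) = X \<bullet> transpose (A ** L)"
        by (simp add: matrix_transpose_mul symA)
      also have "\<dots> = (A ** X) \<bullet> L"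
        by (simp add: inner_transpose X inner_matrix_mult_left symA)
      finally have "X \<bullet> (transpose L ** A) = (A ** X) \<bullet> L" .
      then show ?thesis
        using orth[of "(0, L, 0, 0, 0)"] inner_matrix_mult_left[of X A L] inner_transpose[of Z L]
        by (simp add: w F'_def zero inner_add_right inner_add_left symA Z)
    qed
    from this[of "A ** X + Z"] have AXZ: "A ** X + Z = 0" by simp
    then have "transpose (A ** X + Z) = 0" by (simp add: t0)
    then have "X ** A + Z = 0" by (simp add: transpose_add matrix_transpose_mul X Z symA)
    with AXZ have comm: "A ** X = X ** A" by (metis add_right_cancel)
    have "trace (matpow A k ** X) = 0" for k
    proof -
      \<comment> \<open>As \<open>d (h i) = d i\<close>, every power of \<open>A\<close> lies in the
        range of \<open>S\<close>, so orthogonality to that range yields the trace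
        conditions.\<close>
      have "S (\<chi> j. d j ^ k) = matpow A k"
        by (simp add: S_def AP matpow_spectral_mat[OF P] h)
      moreover have "X \<bullet> S (\<chi> j. d j ^ k) = 0"
        using orth[of "(0, 0, (\<chi> j. d j ^ k), 0, 0)"] by (simp add: w F'_def zero)
      moreover have "transpose (matpow A k) = matpow A k"
        by (simp add: AP matpow_spectral_mat[OF P] transpose_spectral_mat)
      ultimately show ?thesis by (simp add: trace_matrix_mult inner_commute)
    qed
    then have "X = 0" using smp X pat comm unfolding SMP_upto_def by blast
    then show "w = 0" using AXZ mult0 by (simp add: w zero_prod_def)
  qed
  then obtain G where G: "linear G" "F' \<circ> G = id"
    using linear_surjective_right_inverse[OF linF'] by blast
  have contF: "continuous_on UNIV F"
    unfolding F_def
    by (intro continuous_on_Pair continuous_on_add continuous_on_diff continuous_on_matrix_mult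
        continuous_on_transpose continuous_on_const linear_continuous_on[OF lin(1)]
        linear_continuous_on[OF lin(2)] linear_continuous_on[OF lin(3)]
        linear_continuous_on[OF lin(4)] linear_continuous_on[OF lin(5)])
  define T where "T = {z :: (real^'n^'n) \<times> (real^'n^'n) \<times> (real^'n) \<times> (real^'n^'n) \<times> (real^'n^'n).
    ?Y z \<in> W \<and> norm (fst (snd (snd z))) < e}"
  have "open T"
  proof -
    have "open {z :: (real^'n^'n) \<times> (real^'n^'n) \<times> (real^'n) \<times> (real^'n^'n) \<times> (real^'n^'n).
        ?Y z \<in> W}"
      unfolding vimage_def[of ?Y W, symmetric]
      by (intro open_vimage[OF W(1)] linear_continuous_on[OF lin(1)])
    moreover have "open {z :: (real^'n^'n) \<times> (real^'n^'n) \<times> (real^'n) \<times> (real^'n^'n) \<times> (real^'n^'n).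
        norm (fst (snd (snd z))) < e}"
      by (intro open_Collect_less continuous_intros)
    ultimately show ?thesis unfolding T_def by (simp add: Collect_conj_eq open_Int)
  qed
  moreover have "?z \<in> T" using Yz W e by (simp add: T_def)
  ultimately have "?z \<in> interior T" by (simp add: interior_open)
  \<comment> \<open>Open mapping at a point where the derivative has a linear right inverse.
    Restricting to \<open>T\<close> keeps \<open>pattern_part E Y\<close> in \<open>W\<close> and
    \<open>x\<close> small.\<close>
  then have "F ?z \<in> interior (F ` T)"
    using G linear_conv_bounded_linear
    by (intro sussmann_open_mapping[OF open_UNIV contF _ der, of G]) auto
  moreover have "F ?z = (A, mat 1)"
  proof -
    have "S 0 = 0" "sk 0 = 0"
      using S sk by (auto dest: bounded_linear.linear linear_0)
    then show ?thesis unfolding F_def using Yz by simp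
  qed
  ultimately obtain \<delta> where \<delta>: "\<delta> > 0" "ball (A, mat 1) \<delta> \<subseteq> F ` T"
    by (auto simp: mem_interior)
  show thesis
  proof (rule that[OF \<delta>(1)])
    fix M assume M: "transpose M = M" "dist M A < \<delta>"
    then have "(M, mat 1) \<in> ball (A, mat 1) \<delta>" by (simp add: dist_Pair_Pair dist_commute)
    then have "(M, mat 1) \<in> F ` T" using \<delta>(2) by (rule rev_subsetD)
    then obtain z where z: "(M, mat 1) = F z" "z \<in> T" by (rule imageE)
    obtain Y L x U V where zz: "z = (Y, L, x, U, V)" by (cases z)
    define C where "C = mat 1 + L"
    have 1: "transpose C ** ?p Y ** C - S x + (U - transpose U) = M"
      and 2: "transpose C ** C + (V - transpose V) = mat 1"
      using z(1) by (simp_all add: F_def zz C_def sk_def)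
    have "transpose C ** C = mat 1"
      by (rule symmetric_eq_if_differ_by_skew[OF _ _ 2]) (simp_all add: matrix_transpose_mul)
    moreover have "transpose C ** ?p Y ** C - S x = M"
      by (rule symmetric_eq_if_differ_by_skew[OF _ M(1) 1])
        (simp add: transpose_diff matrix_transpose_mul transpose_pattern_part[OF E] S_def
          transpose_spectral_mat matrix_mul_assoc)
    ultimately show "\<exists>Y C x. ?p Y \<in> W \<and> norm (x::real^'n) < e \<and> orthogonal_matrix C
        \<and> transpose C ** ?p Y ** C = M + spectral_mat P (\<lambda>i. x $ h i)"
      using z(2) by (intro exI[of _ Y] exI[of _ C] exI[of _ x])
        (auto simp: T_def zz S_def orthogonal_matrix algebra_simps)
  qed
qed

section \<open>Splitting multiple eigenvalues\<close>

lemma finite_range_gap: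
  fixes d :: "'n::finite \<Rightarrow> real"
  obtains \<gamma> where "\<gamma> > 0" "\<And>i j. d i \<noteq> d j \<Longrightarrow> \<gamma> \<le> \<bar>d i - d j\<bar>"
proof -
  \<comment> \<open>The \<open>1\<close> keeps the set nonempty when \<open>d\<close> is
    constant.\<close>
  let ?S = "insert 1 ((\<lambda>(i,j). \<bar>d i - d j\<bar>) ` {(i,j). d i \<noteq> d j})"
  show thesis
  proof (rule that[of "Min ?S"])
    show "Min ?S > 0" by (subst Min_gr_iff) auto
    show "Min ?S \<le> \<bar>d i - d j\<bar>" if "d i \<noteq> d j" for i j
      by (rule Min_le) (use that in auto)
  qed
qed

text \<open>A fixed \<open>m\<close> handles the SSP and the SMP at once.\<close>

lemma SMP_upto_increase_qnum:
  fixes E :: "'n::finite \<Rightarrow> 'n \<Rightarrow> bool" and A :: "real^'n^'n"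
  assumes E: "simple_graph E" and A: "A \<in> SG E" and smp: "SMP_upto E m A"
    and q: "qnum A \<le> q'" "q' \<le> CARD('n)"
  shows "\<exists>A'\<in>SG E. SMP_upto E m A' \<and> qnum A' = q'"
proof -
  have "transpose A = A" using A by (simp add: SG_def sym_mat_def)
  then obtain P d where P: "orthogonal_matrix P" and AP: "A = spectral_mat P d"
    using symmetric_matrix_spectral by blast
  \<comment> \<open>\<open>r\<close> picks one index per eigenvalue of \<open>A\<close>, so
    \<open>x $ h i\<close> is constant on each eigenvalue class.\<close>
  define r where "r = (\<lambda>c. SOME j. d j = c)"
  define h where "h = (\<lambda>i. r (d i))"
  have h: "d (h i) = d i" for i
    unfolding h_def r_def by (rule someI[of _ i]) simp
  have "inj_on r (range d)" by (rule inj_on_inverseI[of _ d]) (auto simp: h[unfolded h_def])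
  moreover have "range h = r ` range d" by (auto simp: h_def)
  ultimately have "card (range h) = qnum A"
    by (simp add: qnum_def AP eigenvalues_spectral_mat[OF P] card_image)
  then obtain R where R: "range h \<subseteq> R" "card R = q'"
    using exists_subset_between[of "range h" q' UNIV] q by auto
  \<comment> \<open>A retraction onto the \<open>q'\<close> indices in \<open>R\<close> that stays
    within eigenvalue classes; its fibres are the groups that will share an eigenvalue.\<close>
  define \<rho> where "\<rho> = (\<lambda>i. if i \<in> R then i else h i)"
  have \<rho>R: "\<rho> i \<in> R" for i using R by (auto simp: \<rho>_def)
  have d\<rho>: "d (\<rho> i) = d i" for i by (simp add: \<rho>_def h)
  obtain f0 :: "'n \<Rightarrow> nat" where "inj f0"
    using ex_bij_betw_finite_nat[of "UNIV :: 'n set"] bij_betw_imp_inj_on by auto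
  define f where "f = (\<lambda>i. real (f0 (\<rho> i)))"
  have f: "f i = f j \<longleftrightarrow> \<rho> i = \<rho> j" for i j
    using \<open>inj f0\<close> by (simp add: f_def inj_eq)
  obtain \<gamma> where \<gamma>: "\<gamma> > 0" "\<And>i j. d i \<noteq> d j \<Longrightarrow> \<gamma> \<le> \<bar>d i - d j\<bar>"
    using finite_range_gap by blast
  \<comment> \<open>The open conditions to preserve; zeros at non-edges come from
    \<open>pattern_part\<close>.\<close>
  define W where "W = {B. SMP_upto E m B} \<inter> (\<Inter>(i,j)\<in>{(i,j). E i j}. {B::real^'n^'n. B $ i $ j \<noteq> 0})"
  have openW: "open W" unfolding W_def
    by (intro open_Int open_SMP_upto open_INT) (auto intro!: open_Collect_neq continuous_intros)
  have AW: "A \<in> W"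
    using A E smp by (auto simp: W_def SG_def simple_graph_def) metis
  have "\<gamma> / 4 > 0" using \<gamma>(1) by simp
  from congruence_locally_onto[OF E A smp P AP h openW AW this]
  obtain \<delta> where \<delta>: "\<delta> > 0"
    "\<And>M. \<lbrakk>transpose M = M; dist M A < \<delta>\<rbrakk> \<Longrightarrow> \<exists>Y C x. pattern_part E Y \<in> W \<and> norm (x::real^'n) < \<gamma> / 4
      \<and> orthogonal_matrix C
      \<and> transpose C ** pattern_part E Y ** C = M + spectral_mat P (\<lambda>i. x $ h i)"
    by blast
  \<comment> \<open>\<open>K\<close> bounds both every \<open>f i\<close> and the norm of the
    perturbation, so one small \<open>t\<close> controls the eigenvalue shifts and the distance from
    \<open>M\<close> to \<open>A\<close>.\<close>
  define K where "K = 1 + (\<Sum>i\<in>UNIV. f i) + norm (spectral_mat P f)"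
  have fnn: "f i \<ge> 0" for i by (simp add: f_def)
  have fK: "f i < K" for i
  proof -
    have "f i \<le> (\<Sum>i\<in>UNIV. f i)" using fnn by (intro member_le_sum) auto
    then show ?thesis unfolding K_def using norm_ge_zero[of "spectral_mat P f"] by linarith
  qed
  have K: "K > 0" using fK[of undefined] fnn[of undefined] by simp
  define t where "t = min (\<gamma> / 4) (\<delta> / 2) / K"
  have t: "t > 0" "t * K \<le> \<gamma> / 4" "t * K < \<delta>"
    using K \<gamma>(1) \<delta>(1) by (auto simp: t_def min_def)
  define M where "M = spectral_mat P (\<lambda>i. d i + t * f i)"
  have "M = A + t *\<^sub>R spectral_mat P f"
    by (simp add: M_def AP spectral_mat_add spectral_mat_scale)
  then have "dist M A = t * norm (spectral_mat P f)"
    using t by (simp add: dist_norm)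
  also have "\<dots> \<le> t * K" using t fnn by (intro mult_left_mono) (auto simp: K_def sum_nonneg)
  also have "\<dots> < \<delta>" by (rule t)
  finally obtain Y C x where YCx: "pattern_part E Y \<in> W" "norm (x::real^'n) < \<gamma> / 4"
      "orthogonal_matrix C"
      "transpose C ** pattern_part E Y ** C = M + spectral_mat P (\<lambda>i. x $ h i)"
    using \<delta>(2)[of M] by (auto simp: M_def transpose_spectral_mat)
  define B where "B = pattern_part E Y"
  define u where "u = (\<lambda>i. d i + t * f i + x $ h i)"
  have "eigenvalues B = range u"
  proof -
    have "eigenvalues B = eigenvalues (transpose C ** B ** C)"
      by (simp add: eigenvalues_orthogonal_conj[OF YCx(3)])
    also have "transpose C ** B ** C = spectral_mat P u"
      by (simp add: B_def YCx(4) M_def u_def spectral_mat_add)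
    finally show ?thesis by (simp add: eigenvalues_spectral_mat[OF P])
  qed
  moreover have "card (range u) = q'"
  proof -
    \<comment> \<open>Within a class the correction cancels and \<open>f\<close> decides. Across
      classes the shifts change a difference by less than \<open>3 * \<gamma> / 4\<close>, below the
      gap \<open>\<gamma>\<close>.\<close>
    have u\<rho>: "u i = u j \<longleftrightarrow> \<rho> i = \<rho> j" for i j
    proof (cases "d i = d j")
      case True
      then show ?thesis using t f[of i j] by (simp add: u_def h_def)
    next
      case False
      have "0 \<le> t * f k \<and> t * f k < \<gamma> / 4" for k
      proof -
        have "t * f k < t * K" using t fK by simp
        then show ?thesis using t mult_nonneg_nonneg[of t "f k"] fnn[of k] by linarith
      qed
      from this[of i] this[of j]
      have "\<bar>t * f i - t * f j\<bar> < \<gamma> / 4" by linarith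
      moreover have "\<bar>x $ h i\<bar> < \<gamma> / 4" "\<bar>x $ h j\<bar> < \<gamma> / 4"
        using component_le_norm_cart[of x] YCx(2) by (meson le_less_trans)+
      ultimately have "u i \<noteq> u j" using \<gamma>(2)[OF False] \<gamma>(1) unfolding u_def by linarith
      moreover have "\<rho> i \<noteq> \<rho> j" using False d\<rho> by metis
      ultimately show ?thesis by simp
    qed
    have \<rho>_id: "\<rho> i = i" if "i \<in> R" for i using that by (simp add: \<rho>_def)
    have "u i = u (\<rho> i)" for i using u\<rho> \<rho>_id \<rho>R by simp
    then have "range u = u ` R" using \<rho>R by blast
    moreover have "inj_on u R" by (rule inj_onI) (simp add: u\<rho> \<rho>_id)
    ultimately show ?thesis using R by (simp add: card_image)
  qed
  ultimately have "qnum B = q'" by (simp add: qnum_def)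
  moreover have "SMP_upto E m B" using YCx(1) by (simp add: W_def B_def)
  moreover have "B \<in> SG E"
  proof -
    have "B $ i $ j \<noteq> 0" if "E i j" for i j using YCx(1) that by (auto simp: W_def B_def)
    moreover have "B $ i $ j = 0" if "i \<noteq> j" "\<not> E i j" for i j
      using that by (simp add: B_def pattern_part_def)
    ultimately show ?thesis
      using transpose_pattern_part[OF E] by (auto simp: SG_def sym_mat_def B_def)
  qed
  ultimately show ?thesis by blast
qed

theorem theorem4p1:
  fixes E :: "'n::finite \<Rightarrow> 'n \<Rightarrow> bool" and A :: "real^'n^'n"
  assumes "simple_graph E" and "A \<in> SG E"
  shows "(SSP A \<longrightarrow> (\<forall>q'. qnum A \<le> q' \<and> q' \<le> CARD('n) \<longrightarrow>
            (\<exists>A' \<in> SG E. SSP A' \<and> qnum A' = q')))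
       \<and> (SMP A \<longrightarrow> (\<forall>q'. qnum A \<le> q' \<and> q' \<le> CARD('n) \<longrightarrow>
            (\<exists>A' \<in> SG E. SMP A' \<and> qnum A' = q')))"
proof (intro conjI impI allI; elim conjE)
  fix q' assume "SSP A" and q: "qnum A \<le> q'" "q' \<le> CARD('n)"
  then obtain A' where "A' \<in> SG E" "SMP_upto E 0 A'" "qnum A' = q'"
    using SMP_upto_increase_qnum[OF assms _ q] SSP_iff_SMP_upto[OF assms] by blast
  then show "\<exists>A'\<in>SG E. SSP A' \<and> qnum A' = q'"
    using SSP_iff_SMP_upto[OF assms(1)] by blast
next
  fix q' assume "SMP A" and q: "qnum A \<le> q'" "q' \<le> CARD('n)"
  \<comment> \<open>\<open>A'\<close> satisfies the property with only \<open>qnum A\<close> trace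
    conditions, which is at least as strong as its SMP since \<open>qnum A \<le> q'\<close>.\<close>
  then obtain A' where "A' \<in> SG E" "SMP_upto E (qnum A) A'" "qnum A' = q'"
    using SMP_upto_increase_qnum[OF assms _ q] SMP_iff_SMP_upto[OF assms] by blast
  then show "\<exists>A'\<in>SG E. SMP A' \<and> qnum A' = q'"
    using SMP_iff_SMP_upto[OF assms(1)] SMP_upto_mono q(1) by metis
qed

end
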